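(* Let $\mathfrak{I}=(X,\mathcal{F},\Sigma)$ be a surjective IFS and suppose $\mathfrak{I}$ has the shadowing property along a transitive point $t\in\Sigma$. Then $\mathfrak{I}$ has the shadowing property along every $\sigma\in\Sigma$.
   Context: $(X,d)$ is a compact metric space, $\mathcal{F}=\{f_0,\ldots,f_{k-1}\}$ is a finite set of continuous self-maps of $X$, $\mathcal{A}=\{0,\ldots,k-1\}$, and $\Sigma\subseteq\mathcal{A}^{\mathbb{N}}$ is a one-sided subshift (closed set invariant under the shift map $\tau(\sigma)_i=\sigma_{i+1}$). The triple $\mathfrak{I}=(X,\mathcal{F},\Sigma)$ is called an iterated function system (IFS); it is surjective if every map in $\mathcal{F}$ is surjective. For a word $u=u_1\cdots u_n$, $f_u=f_{u_n}\circ\cdots\circ f_{u_1}$. A point $t\in\Sigma$ is transitive if every word appearing in some point of $\Sigma$ appears in $t$ infinitely often. For $\delta>0$, a sequence $\{x_0,x_1,\ldots\}\subseteq X$ is a $\delta$-pseudo orbit along $\sigma=\sigma_1\sigma_2\cdots\in\Sigma$ if $d(f_{\sigma_i}(x_{i-1}),x_i)<\delta$ for all $i\ge1$. $\mathfrak{I}$ has the shadowing property along $\sigma$ if for every $\epsilon>0$ there is $\delta>0$ such that for every $\delta$-pseudo orbit $\{x_0,x_1,\ldots\}$ along $\sigma$ there is $y\in X$ with $d(y,x_0)<\epsilon$ and $d(f_{\sigma_1\cdots\sigma_i}(y),x_i)<\epsilon$ for all $i\ge1$. *)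

theory Defs
  imports "HOL-Analysis.Analysis"
begin

text \<open>
  The alphabet is \<open>{..<k}\<close>. Symbolic sequences are indexed from 0: the paper's
  \<open>\<sigma> = \<sigma>\<^sub>1\<sigma>\<^sub>2\<dots>\<close> is a function \<open>\<sigma>\<close> whose value \<open>\<sigma> i\<close> is the symbol \<open>\<sigma>\<^sub>i\<^sub>+\<^sub>1\<close>.
  The metric space \<open>X\<close> is a set in a type of class \<open>metric_space\<close>; the values of the maps
  \<open>f i\<close> outside \<open>X\<close>, and of \<open>f i\<close> for \<open>i \<ge> k\<close>, are irrelevant.
\<close>

definition shift_map :: "(nat \<Rightarrow> nat) \<Rightarrow> nat \<Rightarrow> nat" where
  "shift_map \<sigma> = (\<lambda>i. \<sigma> (Suc i))"

text \<open>\<open>closedin\<close> includes the requirement that all points of \<open>S\<close> have their symbols in \<open>{..<k}\<close>.\<close>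

definition subshift :: "nat \<Rightarrow> (nat \<Rightarrow> nat) set \<Rightarrow> bool" where
  "subshift k S \<longleftrightarrow>
     closedin (product_topology (\<lambda>_::nat. discrete_topology {..<k}) UNIV) S \<and>
     shift_map ` S \<subseteq> S"

definition IFS ::
  "'a::metric_space set \<Rightarrow> nat \<Rightarrow> (nat \<Rightarrow> 'a \<Rightarrow> 'a) \<Rightarrow> (nat \<Rightarrow> nat) set \<Rightarrow> bool" where
  "IFS X k f S \<longleftrightarrow>
     compact X \<and> (\<forall>i<k. continuous_on X (f i) \<and> f i ` X \<subseteq> X) \<and> subshift k S"

definition surjective_IFS ::
  "'a::metric_space set \<Rightarrow> nat \<Rightarrow> (nat \<Rightarrow> 'a \<Rightarrow> 'a) \<Rightarrow> (nat \<Rightarrow> nat) set \<Rightarrow> bool" where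
  "surjective_IFS X k f S \<longleftrightarrow> IFS X k f S \<and> (\<forall>i<k. f i ` X = X)"

text \<open>\<open>fold\<close> applies the first letter first: \<open>f\<^sub>u = f\<^sub>u\<^sub>n \<circ> \<dots> \<circ> f\<^sub>u\<^sub>1\<close> for \<open>u = u\<^sub>1\<dots>u\<^sub>n\<close>.\<close>

definition word_map :: "(nat \<Rightarrow> 'a \<Rightarrow> 'a) \<Rightarrow> nat list \<Rightarrow> 'a \<Rightarrow> 'a" where
  "word_map f u = fold f u"

definition appears_at :: "nat list \<Rightarrow> (nat \<Rightarrow> nat) \<Rightarrow> nat \<Rightarrow> bool" where
  "appears_at u \<sigma> j \<longleftrightarrow> map \<sigma> [j..<j + length u] = u"

definition transitive_point :: "(nat \<Rightarrow> nat) set \<Rightarrow> (nat \<Rightarrow> nat) \<Rightarrow> bool" where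
  "transitive_point S t \<longleftrightarrow>
     t \<in> S \<and> (\<forall>u. (\<exists>\<sigma>\<in>S. \<exists>j. appears_at u \<sigma> j) \<longrightarrow> infinite {j. appears_at u t j})"

definition pseudo_orbit_along ::
  "'a::metric_space set \<Rightarrow> (nat \<Rightarrow> 'a \<Rightarrow> 'a) \<Rightarrow> (nat \<Rightarrow> nat) \<Rightarrow> real \<Rightarrow> (nat \<Rightarrow> 'a) \<Rightarrow> bool" where
  "pseudo_orbit_along X f \<sigma> \<delta> x \<longleftrightarrow>
     (\<forall>i. x i \<in> X) \<and> (\<forall>i. dist (f (\<sigma> i) (x i)) (x (Suc i)) < \<delta>)"

text \<open>The list \<open>map \<sigma> [0..<i]\<close> is the prefix \<open>\<sigma>\<^sub>1\<dots>\<sigma>\<^sub>i\<close> of length \<open>i\<close>.\<close>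

definition shadowing_along ::
  "'a::metric_space set \<Rightarrow> (nat \<Rightarrow> 'a \<Rightarrow> 'a) \<Rightarrow> (nat \<Rightarrow> nat) \<Rightarrow> bool" where
  "shadowing_along X f \<sigma> \<longleftrightarrow>
     (\<forall>\<epsilon>>0. \<exists>\<delta>>0. \<forall>x. pseudo_orbit_along X f \<sigma> \<delta> x \<longrightarrow>
        (\<exists>y\<in>X. dist y (x 0) < \<epsilon> \<and>
               (\<forall>i\<ge>1. dist (word_map f (map \<sigma> [0..<i]) y) (x i) < \<epsilon>)))"

end

theory Submission
  imports Defs
begin

text \<open>
  Every prefix of \<open>\<sigma>\<close> occurs in \<open>t\<close>. Surjectivity lets us extend a finite pseudo orbit along
  this prefix backwards to the start of \<open>t\<close> by a true orbit (forwards this is always possible),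
  and the resulting pseudo orbit along \<open>t\<close> is shadowed. Hence all finite prefixes of a pseudo
  orbit along \<open>\<sigma>\<close> are shadowed, with a \<open>\<delta>\<close> independent of their length, and a limit point of
  the shadowing points shadows the whole pseudo orbit.
\<close>

lemma word_map_append: "word_map f (u @ v) x = word_map f v (word_map f u x)"
  by (simp add: word_map_def)

lemma word_map_image:
  assumes "\<And>i. i \<in> set u \<Longrightarrow> f i ` X = X"
  shows "word_map f u ` X = X"
  using assms
proof (induction u)
  case Nil
  show ?case by (simp add: word_map_def)
next
  case (Cons a u)
  have "word_map f (a # u) ` X = word_map f u ` f a ` X"
    by (simp add: word_map_def image_image)
  with Cons show ?case by simp
qed

lemma continuous_on_word_map:
  assumes "\<And>i. i \<in> set u \<Longrightarrow> continuous_on X (f i)" "\<And>i. i \<in> set u \<Longrightarrow> f i ` X \<subseteq> X"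
  shows "continuous_on X (word_map f u)"
  using assms
proof (induction u)
  case Nil
  show ?case by (simp add: word_map_def continuous_on_id)
next
  case (Cons a u)
  have "word_map f (a # u) = word_map f u \<circ> f a"
    by (simp add: word_map_def fun_eq_iff)
  moreover have "continuous_on (f a ` X) (word_map f u)"
    by (rule continuous_on_subset[of X]) (use Cons in simp_all)
  ultimately show ?case
    using Cons.prems(1)[of a] by (simp only: continuous_on_compose list.set_intros)
qed

text \<open>A closed set lies inside the whole product space over \<open>{..<k}\<close>. This is
  what lets the hypotheses on \<open>f i\<close> for \<open>i < k\<close> apply to every letter of
  \<open>t\<close> and \<open>\<sigma>\<close>.\<close>

lemma subshift_symbol_less:
  assumes "subshift k S" "\<sigma> \<in> S"
  shows "\<sigma> i < k"
proof -
  have "S \<subseteq> topspace (product_topology (\<lambda>_::nat. discrete_topology {..<k}) UNIV)"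
    using assms(1) unfolding subshift_def by (blast dest: closedin_subset)
  with assms(2) have "\<sigma> \<in> (\<Pi>\<^sub>E i\<in>UNIV. {..<k})"
    by (auto simp only: topspace_product_topology topspace_discrete_topology)
  then show ?thesis by (simp add: PiE_iff)
qed

text \<open>Outside the block occupying times \<open>j\<close> to \<open>j + n\<close>,
  \<open>w\<close> follows true orbits, and it enters and leaves the block without a jump. Its only
  errors are therefore those of \<open>x\<close>, so the same \<open>\<delta>\<close> serves for all
  \<open>n\<close> and \<open>j\<close>.\<close>

lemma embed_finite_pseudo_orbit:
  assumes surj: "\<And>i. f (t i) ` X = X"
    and app: "\<And>i. i < n \<Longrightarrow> t (j + i) = \<sigma> i"
    and x: "\<And>i. x i \<in> X" "\<And>i. i < n \<Longrightarrow> dist (f (\<sigma> i) (x i)) (x (Suc i)) < \<delta>"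
    and "\<delta> > 0"
  obtains w where "pseudo_orbit_along X f t \<delta> w" "\<And>i. i \<le> n \<Longrightarrow> w (j + i) = x i"
proof -
  have img: "word_map f (map t [a..<b]) ` X = X" for a b
    using surj by (intro word_map_image) auto
  then have mem: "word_map f (map t [a..<b]) p \<in> X" if "p \<in> X" for a b p
    using that by blast
  \<comment> \<open>Surjectivity of the maps is used here: some true orbit along \<open>t\<close>
    arrives exactly at \<open>x 0\<close> at time \<open>j\<close>.\<close>
  obtain z where z: "z \<in> X" "word_map f (map t [0..<j]) z = x 0"
    using x(1)[of 0] img[of 0 j] by (metis imageE)
  \<comment> \<open>At \<open>m = j + n\<close> the last branch applies the empty word and gives
    \<open>x n\<close>, so the block contains all of \<open>x 0\<close>, ...,
    \<open>x n\<close>.\<close>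
  define w where "w m = (if m < j then word_map f (map t [0..<m]) z
      else if m < j + n then x (m - j) else word_map f (map t [j + n..<m]) (x n))" for m
  have wj: "w (j + i) = x i" if "i \<le> n" for i
    using that by (auto simp: w_def word_map_def)
  have "w m \<in> X" for m
    using mem z(1) x(1) unfolding w_def by simp
  moreover have "dist (f (t m) (w m)) (w (Suc m)) < \<delta>" for m
  proof -
    \<comment> \<open>The error is zero in cases 1 and 4, which stay on a true orbit, and in case 2,
      where the orbit of \<open>z\<close> reaches \<open>x 0\<close>. Case 3 inherits the error of
      \<open>x\<close>.\<close>
    consider "Suc m < j" | "Suc m = j" | "j \<le> m" "m < j + n" | "j + n \<le> m" by linarith
    then show ?thesis
    proof cases
      case 1
      then show ?thesis using \<open>\<delta> > 0\<close> by (simp add: w_def word_map_def)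
    next
      case 2
      then have "f (t m) (w m) = word_map f (map t [0..<j]) z"
        by (auto simp: w_def word_map_def)
      then show ?thesis using 2 z(2) wj[of 0] \<open>\<delta> > 0\<close> by simp
    next
      case 3
      then obtain i where i: "m = j + i" "i < n"
        using le_Suc_ex by auto
      then show ?thesis using wj[of i] wj[of "Suc i"] x(2)[of i] app[of i] by simp
    next
      case 4
      then show ?thesis using \<open>\<delta> > 0\<close> by (simp add: w_def word_map_def)
    qed
  qed
  ultimately have "pseudo_orbit_along X f t \<delta> w"
    by (simp add: pseudo_orbit_along_def)
  with wj show thesis by (rule that[rotated])
qed

text \<open>The case \<open>i = 0\<close> is the condition on the initial point, since \<open>word_map f []\<close> is the identity.\<close>

lemma shadowing_along_alt:
  "shadowing_along X f \<sigma> \<longleftrightarrow>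
     (\<forall>\<epsilon>>0. \<exists>\<delta>>0. \<forall>x. pseudo_orbit_along X f \<sigma> \<delta> x \<longrightarrow>
        (\<exists>y\<in>X. \<forall>i. dist (word_map f (map \<sigma> [0..<i]) y) (x i) < \<epsilon>))"
proof -
  have "(P 0 \<and> (\<forall>i\<ge>1. P i)) \<longleftrightarrow> (\<forall>i. P i)" for P :: "nat \<Rightarrow> bool"
    by (metis One_nat_def Suc_leI gr0I)
  from this[of "\<lambda>i. dist (word_map f (map \<sigma> [0..<i]) y) (x i) < \<epsilon>" for y x \<epsilon>]
  have "(dist y (x 0) < \<epsilon> \<and> (\<forall>i\<ge>1. dist (word_map f (map \<sigma> [0..<i]) y) (x i) < \<epsilon>)) \<longleftrightarrow>
      (\<forall>i. dist (word_map f (map \<sigma> [0..<i]) y) (x i) < \<epsilon>)" for x y \<epsilon>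
    unfolding word_map_def by simp
  then show ?thesis
    unfolding shadowing_along_def by simp
qed

text \<open>By compactness the points that work up to \<open>n\<close> have a convergent
  subsequence. Each single bound holds along it from some index on and passes to the limit by
  continuity; the inequality is non-strict because limits preserve only that form.\<close>

lemma shadow_limit:
  fixes X :: "'a::metric_space set"
  assumes "compact X" and cont: "\<And>i. continuous_on X (g i)"
    and fin: "\<And>n. \<exists>y\<in>X. \<forall>i\<le>n. dist (g i y) (x i) \<le> \<epsilon>"
  shows "\<exists>y\<in>X. \<forall>i::nat. dist (g i y) (x i) \<le> \<epsilon>"
proof -
  obtain y where y: "\<And>n::nat. y n \<in> X" "\<And>n i. i \<le> n \<Longrightarrow> dist (g i (y n)) (x i) \<le> \<epsilon>"
    using fin by metis
  obtain l r where l: "l \<in> X" "strict_mono (r :: nat \<Rightarrow> nat)" "(y \<circ> r) \<longlonglongrightarrow> l"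
    using seq_compactE[of X y] compact_imp_seq_compact[OF \<open>compact X\<close>] y(1) by blast
  have "dist (g i l) (x i) \<le> \<epsilon>" for i
  proof (rule tendsto_upperbound)
    have "(\<lambda>n. g i ((y \<circ> r) n)) \<longlonglongrightarrow> g i l"
      using y(1) by (intro continuous_on_tendsto_compose[OF cont l(3,1)]) simp
    then show "(\<lambda>n. dist (g i ((y \<circ> r) n)) (x i)) \<longlonglongrightarrow> dist (g i l) (x i)"
      by (intro tendsto_dist tendsto_const)
    \<comment> \<open>Since \<open>r n \<ge> n\<close>, every \<open>n \<ge> i\<close> gives
      \<open>i \<le> r n\<close>, so the bound at \<open>i\<close> is available.\<close>
    show "\<forall>\<^sub>F n in sequentially. dist (g i ((y \<circ> r) n)) (x i) \<le> \<epsilon>"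
      using y(2) le_trans[OF _ seq_suble[OF l(2)]] by (intro eventually_sequentiallyI[of i]) simp
  qed simp
  with l(1) show ?thesis by blast
qed

theorem proposition3p9:
  fixes X :: "'a::metric_space set" and k :: nat and f :: "nat \<Rightarrow> 'a \<Rightarrow> 'a"
    and S :: "(nat \<Rightarrow> nat) set" and t :: "nat \<Rightarrow> nat"
  assumes "surjective_IFS X k f S"
    and "transitive_point S t"
    and "shadowing_along X f t"
  shows "\<forall>\<sigma>\<in>S. shadowing_along X f \<sigma>"
proof
  fix \<sigma> assume "\<sigma> \<in> S"
  have "compact X" and "subshift k S" and cont: "\<And>i. i < k \<Longrightarrow> continuous_on X (f i)"
    and surj: "\<And>i. i < k \<Longrightarrow> f i ` X = X"
    using assms(1) unfolding surjective_IFS_def IFS_def by auto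
  have into: "f i p \<in> X" if "i < k" "p \<in> X" for i p
    using surj that by blast
  have "t \<in> S" and trans: "\<And>u \<sigma> j. \<sigma> \<in> S \<Longrightarrow> appears_at u \<sigma> j \<Longrightarrow> infinite {j. appears_at u t j}"
    using assms(2) unfolding transitive_point_def by auto
  have less: "t i < k" "\<sigma> i < k" for i
    using subshift_symbol_less[OF \<open>subshift k S\<close>] \<open>t \<in> S\<close> \<open>\<sigma> \<in> S\<close> by auto
  show "shadowing_along X f \<sigma>"
    unfolding shadowing_along_alt
  proof (intro allI impI)
    fix \<epsilon> :: real assume "\<epsilon> > 0"
    \<comment> \<open>Shadowing along \<open>t\<close> is invoked with \<open>\<epsilon> / 2\<close>
      because the limit yields only a non-strict bound, which must still be below
      \<open>\<epsilon>\<close>.\<close>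
    then obtain \<delta> where "\<delta> > 0" and \<delta>: "\<And>w. pseudo_orbit_along X f t \<delta> w \<Longrightarrow>
        \<exists>y\<in>X. \<forall>i. dist (word_map f (map t [0..<i]) y) (w i) < \<epsilon> / 2"
      using assms(3) unfolding shadowing_along_alt by (meson half_gt_zero)
    have "\<exists>y\<in>X. \<forall>i. dist (word_map f (map \<sigma> [0..<i]) y) (x i) < \<epsilon>"
      if x: "pseudo_orbit_along X f \<sigma> \<delta> x" for x
    proof -
      have "\<exists>y\<in>X. \<forall>i\<le>n. dist (word_map f (map \<sigma> [0..<i]) y) (x i) \<le> \<epsilon> / 2" for n
      proof -
        have "appears_at (map \<sigma> [0..<n]) \<sigma> 0"
          by (simp add: appears_at_def)
        with trans[OF \<open>\<sigma> \<in> S\<close>] have "{j. appears_at (map \<sigma> [0..<n]) t j} \<noteq> {}"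
          by (metis finite.emptyI)
        then obtain j where j: "map t [j..<j + n] = map \<sigma> [0..<n]"
          by (auto simp: appears_at_def)
        have app: "t (j + i) = \<sigma> i" if "i < n" for i
          using arg_cong[OF j, of "\<lambda>u. u ! i"] that by simp
        obtain w where "pseudo_orbit_along X f t \<delta> w" and w: "\<And>i. i \<le> n \<Longrightarrow> w (j + i) = x i"
          using embed_finite_pseudo_orbit[of f t X n j \<sigma> x \<delta>] surj less app x \<open>\<delta> > 0\<close>
          unfolding pseudo_orbit_along_def by metis
        then obtain y where "y \<in> X"
          and y: "\<And>i. dist (word_map f (map t [0..<i]) y) (w i) < \<epsilon> / 2"
          using \<delta> by blast
        \<comment> \<open>The orbit of \<open>y\<close> is at \<open>y'\<close> at time
          \<open>j\<close>, when \<open>t\<close> starts to read the prefix of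
          \<open>\<sigma>\<close> and \<open>w\<close> starts to follow \<open>x\<close>.\<close>
        define y' where "y' = word_map f (map t [0..<j]) y"
        have "word_map f (map t [0..<j]) ` X = X"
          using surj less by (intro word_map_image) auto
        then have "y' \<in> X"
          using \<open>y \<in> X\<close> unfolding y'_def by blast
        moreover have "dist (word_map f (map \<sigma> [0..<i]) y') (x i) \<le> \<epsilon> / 2" if "i \<le> n" for i
        proof -
          have "map \<sigma> [0..<i] = map t [j..<j + i]"
            using app that by (intro nth_equalityI) auto
          then have "word_map f (map \<sigma> [0..<i]) y' = word_map f (map t [0..<j + i]) y"
            unfolding y'_def by (simp add: upt_add_eq_append[of 0 j i] word_map_append)
          then show ?thesis
            using y[of "j + i"] w[OF that] by simp
        qed
        ultimately show ?thesis by blast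
      qed
      \<comment> \<open>The position \<open>j\<close> and the point \<open>y'\<close> vary with
        \<open>n\<close>, but \<open>\<delta>\<close> was fixed beforehand, so the finite statements
        hold for all \<open>n\<close> and the limit argument applies.\<close>
      then have "\<exists>y\<in>X. \<forall>i. dist (word_map f (map \<sigma> [0..<i]) y) (x i) \<le> \<epsilon> / 2"
        using cont into less
        by (intro shadow_limit[OF \<open>compact X\<close>] continuous_on_word_map) auto
      moreover have "\<epsilon> / 2 < \<epsilon>"
        using \<open>\<epsilon> > 0\<close> by simp
      ultimately show ?thesis
        by (meson le_less_trans)
    qed
    with \<open>\<delta> > 0\<close> show "\<exists>\<delta>>0. \<forall>x. pseudo_orbit_along X f \<sigma> \<delta> x \<longrightarrow>
        (\<exists>y\<in>X. \<forall>i. dist (word_map f (map \<sigma> [0..<i]) y) (x i) < \<epsilon>)"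
      by blast
  qed
qed

end
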